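(* Let $k\geq 2$, let $\mathcal{A}_1,\mathcal{A}_2$ be finite alphabets, and let $\pi:\mathcal{A}_1^*\to\mathcal{A}_2^*$ be a morphism with $|\pi(a)|=k$ for every $a\in\mathcal{A}_1$ and such that $\pi(a)\sim_{ab}\pi(b)$ for every pair of letters $a,b\in\mathcal{A}_1$. Let $\mathbf{w}\in\mathcal{A}_1^{\mathbb{N}}$ be an infinite sequence whose boundary sequence $\{\partial\mathcal{F}_n(\mathbf{w})\}_{n\geq 2}$ is $k$-automatic, and let $\mathbf{u}=\pi(\mathbf{w})\in\mathcal{A}_2^{\mathbb{N}}$. Then the abelian complexity sequence $\{\rho_n^{ab}(\mathbf{u})\}_{n\geq 1}$ is $k$-automatic.
   Context: For a word $v$ over an alphabet $\{a_0,\dots,a_{q-1}\}$, its Parikh vector is $\psi(v)=(|v|_{a_0},\dots,|v|_{a_{q-1}})$, where $|v|_a$ is the number of occurrences of $a$ in $v$; two words $u,v$ are abelian equivalent, $u\sim_{ab}v$, if $\psi(u)=\psi(v)$. For an infinite word $\mathbf{w}$, $\mathcal{F}_n(\mathbf{w})$ is the set of factors of $\mathbf{w}$ of length $n$, and $\rho_n^{ab}(\mathbf{w})=\#\{\psi(v):v\in\mathcal{F}_n(\mathbf{w})\}$. For a finite word $u=u_0\cdots u_{n-1}$ with $n\geq 2$, its boundary word is $\partial u=u_0u_{n-1}$, and $\partial\mathcal{F}_n(\mathbf{w})=\{\partial u: u\in\mathcal{F}_n(\mathbf{w})\}\subseteq\mathcal{A}_1\times\mathcal{A}_1$; thus $\{\partial\mathcal{F}_n(\mathbf{w})\}_{n\geq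 2}$ is a sequence over the finite set of subsets of $\mathcal{A}_1\times\mathcal{A}_1$. A sequence $(x_n)_{n\geq 0}$ over a finite set is $k$-automatic if its $k$-kernel $\{(x_{k^e n+c})_{n\geq 0}: e\geq 0,\ 0\leq c<k^e\}$ is finite (sequences indexed from a different starting point are reindexed accordingly). The morphism $\pi$ is extended to infinite words letter by letter. *)

theory Defs
  imports Complex_Main
begin

text \<open>Finite words are lists and infinite words are functions on \<^typ>\<open>nat\<close>;
  a finite alphabet is a type of class \<^class>\<open>finite\<close>.\<close>

definition parikh :: "'a list \<Rightarrow> 'a \<Rightarrow> nat" where
  "parikh v = (\<lambda>a. count_list v a)"

definition abelian_equiv :: "'a list \<Rightarrow> 'a list \<Rightarrow> bool" (infix "\<sim>\<^sub>a\<^sub>b" 50) where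
  "u \<sim>\<^sub>a\<^sub>b v \<longleftrightarrow> parikh u = parikh v"

definition factors :: "nat \<Rightarrow> (nat \<Rightarrow> 'a) \<Rightarrow> 'a list set" where
  "factors n w = {map w [i..<i + n] | i. True}"

definition abelian_complexity :: "(nat \<Rightarrow> 'a) \<Rightarrow> nat \<Rightarrow> nat" where
  "abelian_complexity w n = card (parikh ` factors n w)"

text \<open>Meaningful for words of length at least 2.\<close>

definition boundary :: "'a list \<Rightarrow> 'a \<times> 'a" where
  "boundary u = (u ! 0, u ! (length u - 1))"

definition boundary_set :: "(nat \<Rightarrow> 'a) \<Rightarrow> nat \<Rightarrow> ('a \<times> 'a) set" where
  "boundary_set w n = boundary ` factors n w"

definition kernel :: "nat \<Rightarrow> (nat \<Rightarrow> 'a) \<Rightarrow> (nat \<Rightarrow> 'a) set" where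
  "kernel k x = {(\<lambda>n. x (k ^ e * n + c)) | e c. c < k ^ e}"

definition automatic :: "nat \<Rightarrow> (nat \<Rightarrow> 'a) \<Rightarrow> bool" where
  "automatic k x \<longleftrightarrow> finite (range x) \<and> finite (kernel k x)"

definition word_morphism :: "('a list \<Rightarrow> 'b list) \<Rightarrow> bool" where
  "word_morphism h \<longleftrightarrow> h [] = [] \<and> (\<forall>u v. h (u @ v) = h u @ h v)"

text \<open>The infinite concatenation \<open>h(w\<^sub>0) h(w\<^sub>1) h(w\<^sub>2) \<dots>\<close>. If \<open>h\<close> erases no letter, the
  first \<open>i + 1\<close> blocks have total length at least \<open>i + 1\<close>, so they already determine the
  letter at position \<open>i\<close>.\<close>

definition morphism_image :: "('a list \<Rightarrow> 'b list) \<Rightarrow> (nat \<Rightarrow> 'a) \<Rightarrow> nat \<Rightarrow> 'b" where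
  "morphism_image h w i = concat (map (\<lambda>j. h [w j]) [0..<Suc i]) ! i"

end

theory Submission
  imports Defs
begin

text \<open>Since all blocks \<open>\<pi>(a)\<close> have the same Parikh vector, the prefix of \<open>\<^bold>u\<close> of length
  \<open>k q + r\<close> with \<open>r < k\<close> has Parikh vector \<open>q \<cdot> c\<close> plus that of the prefix of length \<open>r\<close> of
  \<open>\<pi>(w\<^sub>q)\<close>. Hence the Parikh vector of a factor of length \<open>k m + s\<close> starting at
  \<open>k q + r\<close> is \<open>m \<cdot> c\<close> plus a term that depends only on \<open>r\<close>, \<open>s\<close> and the letters \<open>w\<^sub>q\<close> and
  \<open>w\<^bsub>q + m + \<epsilon>\<^esub>\<close>, where \<open>\<epsilon> = (r + s) div k \<in> {0, 1}\<close>. So the abelian complexity at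
  \<open>k m + s\<close> is a function of \<open>s\<close> and the boundary sets of lengths \<open>m + 1\<close> and \<open>m + 2\<close>, and
  the closure of automatic sequences under shifts, products and interleaving finishes the
  proof.\<close>

section \<open>Automatic sequences\<close>

text \<open>The kernel is the least set that contains \<open>x\<close> and is closed under passing
  to residue classes mod k, so any finite closed set containing \<open>x\<close> bounds it.\<close>

lemma automaticI:
  assumes "finite (range x)" and "finite S" and "x \<in> S"
    and closed: "\<And>y s. y \<in> S \<Longrightarrow> s < k \<Longrightarrow> (\<lambda>n. y (k * n + s)) \<in> S"
  shows "automatic k x"
proof -
  have "(\<lambda>n. x (k ^ e * n + c)) \<in> S" if "c < k ^ e" for e c
    using that
  proof (induction e arbitrary: c)
    case 0
    then show ?case using \<open>x \<in> S\<close> by simp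
  next
    case (Suc e)
    \<comment> \<open>In base k, \<open>?y\<close> accounts for the lower e digits of c; the leading
      digit \<open>c div k ^ e\<close> is the residue taken last.\<close>
    let ?y = "\<lambda>n. x (k ^ e * n + c mod k ^ e)"
    have "k ^ e > 0" using Suc.prems by (cases "k = 0") auto
    then have "?y \<in> S" by (intro Suc.IH mod_less_divisor)
    moreover have "c div k ^ e < k"
      using Suc.prems by (simp add: less_mult_imp_div_less)
    ultimately have "(\<lambda>n. ?y (k * n + c div k ^ e)) \<in> S"
      by (rule closed)
    moreover have "k ^ e * (k * n + c div k ^ e) + c mod k ^ e = k ^ Suc e * n + c" for n
      using mult_div_mod_eq[of "k ^ e" c] by (simp add: algebra_simps)
    ultimately show ?case by simp
  qed
  then have "kernel k x \<subseteq> S" by (auto simp: kernel_def)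
  then show ?thesis
    using assms finite_subset unfolding automatic_def by blast
qed

lemma self_in_kernel: "x \<in> kernel k x"
  unfolding kernel_def by (rule CollectI, rule exI[of _ 0], rule exI[of _ 0]) simp

lemma kernel_closed:
  assumes "y \<in> kernel k x" and "s < k"
  shows "(\<lambda>n. y (k * n + s)) \<in> kernel k x"
proof -
  obtain e c where c: "c < k ^ e" and y: "y = (\<lambda>n. x (k ^ e * n + c))"
    using assms(1) by (auto simp: kernel_def)
  have "k ^ e * s + c < k ^ e * Suc s" using c by simp
  also have "\<dots> \<le> k ^ Suc e"
    using assms(2) by (metis Suc_leI mult.commute mult_le_mono1 power_Suc)
  finally have "k ^ e * s + c < k ^ Suc e" .
  moreover have "(\<lambda>n. y (k * n + s)) = (\<lambda>n. x (k ^ Suc e * n + (k ^ e * s + c)))"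
    by (simp add: y algebra_simps)
  ultimately show ?thesis unfolding kernel_def by blast
qed

text \<open>Residue s of the shift is residue s + 1 of the sequence; for s = k - 1 a carry yields
  the shift of residue 0. So the kernel together with its shifts is closed.\<close>

lemma automatic_shift:
  assumes "automatic k x"
  shows "automatic k (\<lambda>n. x (Suc n))"
proof (rule automaticI)
  let ?S = "kernel k x \<union> (\<lambda>y n. y (Suc n)) ` kernel k x"
  show "finite (range (\<lambda>n. x (Suc n)))"
    using assms by (auto simp: automatic_def intro: finite_subset[of _ "range x"])
  show "finite ?S" using assms by (simp add: automatic_def)
  show "(\<lambda>n. x (Suc n)) \<in> ?S" using self_in_kernel by blast
  fix y s
  assume "y \<in> ?S" and s: "s < k"
  then consider "y \<in> kernel k x" | z where "z \<in> kernel k x" "y = (\<lambda>n. z (Suc n))" by blast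
  then show "(\<lambda>n. y (k * n + s)) \<in> ?S"
  proof cases
    case 1
    then show ?thesis using kernel_closed s by blast
  next
    case z: 2
    show ?thesis
    proof (cases "Suc s < k")
      case True
      then show ?thesis using kernel_closed[OF z(1) True] by (simp add: z(2))
    next
      case False
      then have "k = Suc s" using s by simp
      then have "(\<lambda>n. y (k * n + s)) = (\<lambda>n. z (k * Suc n + 0))"
        by (simp add: z(2) algebra_simps)
      moreover have "(\<lambda>n. z (k * n + 0)) \<in> kernel k x"
        using kernel_closed[OF z(1), of 0] s by simp
      ultimately show ?thesis by (intro UnI2 image_eqI)
    qed
  qed
qed

text \<open>Here residue 0 borrows: it is \<open>a\<close> followed by residue k - 1 of the old
  sequence.\<close>

lemma automatic_case_nat:
  assumes "automatic k x"
  shows "automatic k (case_nat a x)"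
proof (rule automaticI)
  let ?S = "kernel k x \<union> case_nat a ` kernel k x"
  have "range (case_nat a x) \<subseteq> insert a (range x)"
    by (auto split: nat.split)
  then show "finite (range (case_nat a x))"
    using assms by (auto simp: automatic_def intro: finite_subset)
  show "finite ?S" using assms by (simp add: automatic_def)
  show "case_nat a x \<in> ?S" using self_in_kernel by blast
  fix y s
  assume "y \<in> ?S" and s: "s < k"
  then consider "y \<in> kernel k x" | z where "z \<in> kernel k x" "y = case_nat a z" by blast
  then show "(\<lambda>n. y (k * n + s)) \<in> ?S"
  proof cases
    case 1
    then show ?thesis using kernel_closed s by blast
  next
    case z: 2
    show ?thesis
    proof (cases s)
      case 0
      obtain l where l: "k = Suc l" using s by (cases k) auto
      have "(\<lambda>n. y (k * n + s)) = case_nat a (\<lambda>n. z (k * n + l))"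
        by (auto simp: fun_eq_iff z(2) 0 l algebra_simps split: nat.split)
      moreover have "(\<lambda>n. z (k * n + l)) \<in> kernel k x"
        using kernel_closed[OF z(1), of l] l by simp
      ultimately show ?thesis by blast
    next
      case (Suc t)
      then show ?thesis using kernel_closed[OF z(1), of t] s by (simp add: z(2))
    qed
  qed
qed

lemma automatic_map2:
  assumes "automatic k x" and "automatic k y"
  shows "automatic k (\<lambda>n. f (x n) (y n))"
proof -
  have "range (\<lambda>n. f (x n) (y n)) \<subseteq> (\<lambda>(a, b). f a b) ` (range x \<times> range y)"
    by auto
  moreover have "kernel k (\<lambda>n. f (x n) (y n))
      \<subseteq> (\<lambda>(p, q) n. f (p n) (q n)) ` (kernel k x \<times> kernel k y)"
  proof
    fix z assume "z \<in> kernel k (\<lambda>n. f (x n) (y n))"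
    then obtain e c where "c < k ^ e"
      and z: "z = (\<lambda>n. f (x (k ^ e * n + c)) (y (k ^ e * n + c)))"
      by (auto simp: kernel_def)
    then have "((\<lambda>n. x (k ^ e * n + c)), (\<lambda>n. y (k ^ e * n + c))) \<in> kernel k x \<times> kernel k y"
      by (auto simp: kernel_def)
    then show "z \<in> (\<lambda>(p, q) n. f (p n) (q n)) ` (kernel k x \<times> kernel k y)"
      by (rule rev_image_eqI) (simp add: z)
  qed
  moreover have "finite (range x \<times> range y)" "finite (kernel k x \<times> kernel k y)"
    using assms by (simp_all add: automatic_def)
  ultimately show ?thesis
    unfolding automatic_def by (meson finite_imageI finite_subset)
qed

text \<open>One step from \<open>x\<close> lands in one of k finite kernels, each of them
  closed.\<close>

lemma automatic_interleave:
  assumes "k > 0" and sub: "\<And>s. s < k \<Longrightarrow> automatic k (\<lambda>n. x (k * n + s))"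
  shows "automatic k x"
proof (rule automaticI)
  let ?S = "insert x (\<Union>s<k. kernel k (\<lambda>n. x (k * n + s)))"
  have "range x \<subseteq> (\<Union>s<k. range (\<lambda>n. x (k * n + s)))"
  proof
    fix v assume "v \<in> range x"
    then obtain n where "v = x (k * (n div k) + n mod k)" by auto
    moreover have "n mod k < k" using \<open>k > 0\<close> by simp
    ultimately show "v \<in> (\<Union>s<k. range (\<lambda>n. x (k * n + s)))" by blast
  qed
  moreover have "finite (\<Union>s<k. range (\<lambda>n. x (k * n + s)))"
    using sub by (auto simp: automatic_def)
  ultimately show "finite (range x)" by (rule finite_subset)
  show "finite ?S" using sub by (auto simp: automatic_def)
  show "x \<in> ?S" by simp
  fix y s
  assume "y \<in> ?S" and "s < k"
  then consider "y = x" | t where "t < k" "y \<in> kernel k (\<lambda>n. x (k * n + t))" by blast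
  then show "(\<lambda>n. y (k * n + s)) \<in> ?S"
  proof cases
    case 1
    then show ?thesis
      using self_in_kernel[of "\<lambda>n. x (k * n + s)" k] \<open>s < k\<close> by blast
  next
    case (2 t)
    then show ?thesis using kernel_closed[OF 2(2) \<open>s < k\<close>] by blast
  qed
qed

section \<open>Images of infinite words under uniform morphisms\<close>

lemma nth_concat_uniform:
  assumes "\<And>xs. xs \<in> set xss \<Longrightarrow> length xs = k" and "q < length xss" and "r < k"
  shows "concat xss ! (k * q + r) = xss ! q ! r"
  using assms
proof (induction xss arbitrary: q)
  case Nil
  then show ?case by simp
next
  case (Cons xs xss)
  then show ?case by (cases q) (auto simp: nth_append)
qed

lemma morphism_image_uniform:
  assumes "\<And>a. length (h [a]) = k" and "r < k"
  shows "morphism_image h w (k * q + r) = h [w q] ! r"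
proof -
  \<comment> \<open>Only k q + r + 1 blocks are concatenated, so block q must be shown to be among
    them.\<close>
  have "1 * q \<le> k * q" using assms(2) by (intro mult_le_mono1) simp
  then have q: "q < Suc (k * q + r)" by linarith
  then have "morphism_image h w (k * q + r)
      = map (\<lambda>j. h [w j]) [0..<Suc (k * q + r)] ! q ! r"
    unfolding morphism_image_def
    by (intro nth_concat_uniform) (use assms in auto)
  then show ?thesis using q by (simp del: upt_Suc)
qed

lemma count_prefix_morphism_image:
  assumes len: "\<And>a. length (h [a]) = k" and c: "\<And>a. count_list (h [a]) x = c"
    and "r < k"
  shows "count_list (map (morphism_image h w) [0..<k * q + r]) x
    = q * c + count_list (take r (h [w q])) x"
proof -
  let ?u = "morphism_image h w"
  \<comment> \<open>The case r = k serves the induction over whole blocks, r < k the final partial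
    block.\<close>
  have block: "map ?u [k * q..<k * q + r] = take r (h [w q])" if "r \<le> k" for q r
    by (rule nth_equalityI) (use that in \<open>auto simp: len morphism_image_uniform\<close>)
  have split: "[0..<i + j] = [0..<i] @ [i..<i + j]" for i j :: nat
    by (rule upt_add_eq_append) simp
  have "count_list (map ?u [0..<k * q]) x = q * c"
  proof (induction q)
    case 0
    then show ?case by simp
  next
    case (Suc q)
    have "[0..<k * Suc q] = [0..<k * q] @ [k * q..<k * q + k]"
      using split[of "k * q" k] by (simp add: add.commute)
    then show ?case using Suc block[of k q] by (simp add: c len)
  qed
  then show ?thesis using \<open>r < k\<close> by (simp add: split block)
qed

text \<open>The case d = 0 gives diagonal pairs, needed for factors lying inside a single
  block.\<close>

lemma boundary_set_Suc: "boundary_set w (Suc d) = range (\<lambda>q. (w q, w (q + d)))"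
proof -
  have "boundary (map w [q..<q + Suc d]) = (w q, w (q + d))" for q
    by (simp add: boundary_def del: upt_Suc)
  moreover have "factors (Suc d) w = range (\<lambda>q. map w [q..<q + Suc d])"
    unfolding factors_def by blast
  ultimately show ?thesis
    unfolding boundary_set_def by (simp only: image_image)
qed

text \<open>For a factor of length \<open>k m + s\<close> of the image word that starts at offset \<open>r\<close> in the
  image of \<open>a\<close> and ends inside the image of \<open>b\<close>: its Parikh vector minus \<open>m \<cdot> c\<close>, where \<open>c\<close> is
  the common Parikh vector of the blocks. The subtraction is why it is integer valued.\<close>

definition reduced_parikh ::
  "('a list \<Rightarrow> 'b list) \<Rightarrow> nat \<Rightarrow> ('b \<Rightarrow> nat) \<Rightarrow> nat \<Rightarrow> nat \<Rightarrow> 'a \<times> 'a \<Rightarrow> 'b \<Rightarrow> int" where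
  "reduced_parikh h k c s r = (\<lambda>(a, b) x. int ((r + s) div k * c x)
     + int (parikh (take ((r + s) mod k) (h [b])) x) - int (parikh (take r (h [a])) x))"

text \<open>The factor is the difference of two prefixes, and the q whole blocks before its first
  block cancel.\<close>

lemma reduced_parikh_factor:
  assumes len: "\<And>a. length (h [a]) = k" and c: "\<And>a. parikh (h [a]) = c" and "r < k"
  shows "int (parikh (map (morphism_image h w) [k * q + r..<k * q + r + (k * m + s)]) x)
      - int (m * c x)
    = reduced_parikh h k c s r (w q, w (q + (m + (r + s) div k))) x"
proof -
  let ?u = "morphism_image h w"
  let ?\<epsilon> = "(r + s) div k"
  define i j where "i = k * q + r" and "j = i + (k * m + s)"
  have c': "count_list (h [a]) x = c x" for a
    using fun_cong[OF c[of a], of x] by (simp add: parikh_def)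
  note prefix = count_prefix_morphism_image[of h k x "c x", OF len c']
  have j: "j = k * (q + (m + ?\<epsilon>)) + (r + s) mod k"
    unfolding i_def j_def using mult_div_mod_eq[of k "r + s"]
    by (simp add: algebra_simps)
  have mod: "(r + s) mod k < k" using \<open>r < k\<close> by simp
  have "[0..<j] = [0..<i] @ [i..<j]"
    unfolding j_def by (rule upt_add_eq_append) simp
  then have "count_list (map ?u [0..<j]) x
      = count_list (map ?u [0..<i]) x + count_list (map ?u [i..<j]) x"
    by simp
  moreover have "count_list (map ?u [0..<i]) x = q * c x + count_list (take r (h [w q])) x"
    unfolding i_def by (rule prefix[OF \<open>r < k\<close>])
  moreover have "count_list (map ?u [0..<j]) x = (q + (m + ?\<epsilon>)) * c x
      + count_list (take ((r + s) mod k) (h [w (q + (m + ?\<epsilon>))])) x"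
    unfolding j by (rule prefix[OF mod])
  \<comment> \<open>Stated additively, so that no truncated subtraction occurs before the passage to
    integers.\<close>
  ultimately have "m * c x + ?\<epsilon> * c x
      + count_list (take ((r + s) mod k) (h [w (q + (m + ?\<epsilon>))])) x
    = count_list (take r (h [w q])) x + count_list (map ?u [i..<j]) x"
    by (simp add: add_mult_distrib)
  then have "int (count_list (map ?u [i..<j]) x) - int (m * c x)
     = reduced_parikh h k c s r (w q, w (q + (m + ?\<epsilon>))) x"
    unfolding reduced_parikh_def parikh_def prod.case by linarith
  then show ?thesis by (simp add: parikh_def i_def j_def)
qed

lemma abelian_complexity_morphism_image:
  assumes len: "\<And>a. length (h [a]) = k" and c: "\<And>a. parikh (h [a]) = c" and "s < k"
  shows "abelian_complexity (morphism_image h w) (k * m + s)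
    = card (\<Union>r<k. reduced_parikh h k c s r `
        (if r + s < k then boundary_set w (m + 1) else boundary_set w (m + 2)))"
    (is "_ = card (\<Union>r<k. ?R r ` ?B r)")
proof -
  let ?u = "morphism_image h w"
  \<comment> \<open>Translation by a fixed vector is injective, so it preserves the cardinality
    while removing the explicit dependence on m.\<close>
  let ?\<Phi> = "\<lambda>(v :: 'b \<Rightarrow> nat) x. int (v x) - int (m * c x)"
  let ?v = "\<lambda>i. parikh (map ?u [i..<i + (k * m + s)])"
  let ?g = "\<lambda>r q. ?R r (w q, w (q + (m + (r + s) div k)))"
  have B: "?B r = range (\<lambda>q. (w q, w (q + (m + (r + s) div k))))" if "r < k" for r
  proof (cases "r + s < k")
    case True
    then show ?thesis by (simp add: boundary_set_Suc)
  next
    case False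
    then have "(r + s) div k = 1"
      using that \<open>s < k\<close> by (intro div_nat_eqI) auto
    then show ?thesis using False boundary_set_Suc[of w "Suc m"] by simp
  qed
  have \<Phi>: "?\<Phi> (?v (k * q + r)) = ?g r q" if "r < k" for q r
    using reduced_parikh_factor[of h k c r w q m s, OF len c that] by (rule ext)
  have "?\<Phi> ` parikh ` factors (k * m + s) ?u = range (\<lambda>i. ?\<Phi> (?v i))"
    unfolding factors_def by blast
  also have "\<dots> = (\<Union>r<k. range (?g r))"
  proof (intro equalityI subsetI)
    fix z assume "z \<in> range (\<lambda>i. ?\<Phi> (?v i))"
    then obtain i where "z = ?\<Phi> (?v (k * (i div k) + i mod k))" by auto
    moreover have "i mod k < k" using \<open>s < k\<close> by simp
    ultimately show "z \<in> (\<Union>r<k. range (?g r))" using \<Phi> by blast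
  next
    fix z assume "z \<in> (\<Union>r<k. range (?g r))"
    then obtain r q where "r < k" "z = ?g r q" by blast
    then have "z = ?\<Phi> (?v (k * q + r))" using \<Phi> by metis
    then show "z \<in> range (\<lambda>i. ?\<Phi> (?v i))" by blast
  qed
  also have "\<dots> = (\<Union>r<k. ?R r ` ?B r)"
  proof (rule SUP_cong[OF refl])
    fix r assume "r \<in> {..<k}"
    then show "range (?g r) = ?R r ` ?B r" using B[of r] by (simp only: lessThan_iff image_image)
  qed
  finally have "?\<Phi> ` parikh ` factors (k * m + s) ?u = (\<Union>r<k. ?R r ` ?B r)" .
  moreover have "inj ?\<Phi>" by (rule injI) (auto simp: fun_eq_iff)
  then have "card (?\<Phi> ` parikh ` factors (k * m + s) ?u) = card (parikh ` factors (k * m + s) ?u)"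
    by (intro card_image) (rule inj_on_subset[OF _ subset_UNIV])
  ultimately show ?thesis
    unfolding abelian_complexity_def by (simp only:)
qed

theorem theorem2:
  fixes k :: nat
    and \<pi> :: "'a::finite list \<Rightarrow> 'b::finite list"
    and w :: "nat \<Rightarrow> 'a"
    and u :: "nat \<Rightarrow> 'b"
  assumes "k \<ge> 2"
    and "word_morphism \<pi>"
    and "\<And>a. length (\<pi> [a]) = k"
    and "\<And>a b. \<pi> [a] \<sim>\<^sub>a\<^sub>b \<pi> [b]"
    and "automatic k (\<lambda>n. boundary_set w (n + 2))"
    and "u = morphism_image \<pi> w"
  shows "automatic k (\<lambda>n. abelian_complexity u (n + 1))"
proof -
  have c: "parikh (\<pi> [a]) = parikh (\<pi> [w 0])" for a
    using assms(4) by (simp add: abelian_equiv_def)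
  \<comment> \<open>The hypothesis starts at length 2, but m = 0 also calls for length 1.\<close>
  have "(\<lambda>n. boundary_set w (n + 1)) = case_nat (boundary_set w 1) (\<lambda>n. boundary_set w (n + 2))"
    by (auto simp: fun_eq_iff split: nat.split)
  then have B1: "automatic k (\<lambda>n. boundary_set w (n + 1))"
    using automatic_case_nat[OF assms(5)] by simp
  have "automatic k (abelian_complexity u)"
  proof (rule automatic_interleave)
    show "k > 0" using assms(1) by simp
    fix s assume "s < k"
    show "automatic k (\<lambda>m. abelian_complexity u (k * m + s))"
      unfolding assms(6) abelian_complexity_morphism_image[of \<pi> k, OF assms(3) c \<open>s < k\<close>]
      \<comment> \<open>For fixed s, the cardinality is a function of the two boundary sets
        alone.\<close>
      by (rule automatic_map2[OF B1 assms(5)])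
  qed
  \<comment> \<open>Interleaving indexes lengths from 0; the shift restores the start at length
    1.\<close>
  then show ?thesis using automatic_shift[of k "abelian_complexity u"] by simp
qed

end
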